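(* Let $q$ be a prime power, let $k\in\mathbb{N}$ with $\gcd(k,q)=1$, and let $\zeta_k$ be a generator of the group of $k$-th roots of unity over $\mathbb{F}_q$. Let $f\in\mathbb{F}_q[X]$ be a polynomial of degree $n$ with $f(0)\neq 0$, and set $$t=\max\{m : m\mid \gcd(n,k),\ f(X)=g(X^m)\text{ for some } g\in\mathbb{F}_q[X]\}.$$ Then for $0\le j,j'\le k-1$, the polynomials $\zeta_k^{-jn}f(\zeta_k^{j}X)$ and $\zeta_k^{-j'n}f(\zeta_k^{j'}X)$ are equal if and only if $j\equiv j'\pmod{k/t}$.
   Context: The group of $k$-th roots of unity over $\mathbb{F}_q$ is the set of roots of $X^k-1$ in an extension field of $\mathbb{F}_q$; for $\gcd(q,k)=1$ it is cyclic of order $k$. *)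

theory Defs
  imports
    "HOL-Library.Cardinality"
    "HOL-Computational_Algebra.Polynomial"
    "HOL-Number_Theory.Cong"
    "HOL-Number_Theory.Prime_Powers"
begin

text \<open>
  The field \<open>F\<^sub>q\<close> is a type of class \<^class>\<open>field\<close> and \<^class>\<open>finite\<close> with \<open>q\<close> elements; an extension
  field is another type of class \<^class>\<open>field\<close> with an embedding into it. Injectivity of
  the embedding is automatic.
\<close>

definition field_embedding :: "('a::field \<Rightarrow> 'b::field) \<Rightarrow> bool" where
  "field_embedding h \<longleftrightarrow>
     h 1 = 1 \<and> (\<forall>x y. h (x + y) = h x + h y) \<and> (\<forall>x y. h (x * y) = h x * h y)"

definition splits :: "'b::field poly \<Rightarrow> bool" where
  "splits p \<longleftrightarrow> (\<exists>A. p = smult (lead_coeff p) (\<Prod>a\<in>#A. [:- a, 1:]))"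

text \<open>
  This is the whole group of \<open>k\<close>-th roots of unity only in a field where \<open>X^k - 1\<close> splits;
  otherwise it is just the part lying in that field.
\<close>

definition roots_of_unity :: "nat \<Rightarrow> 'b::field set" where
  "roots_of_unity k = {x. poly (monom 1 k - 1) x = 0}"

definition generates_roots_of_unity :: "nat \<Rightarrow> 'b::field \<Rightarrow> bool" where
  "generates_roots_of_unity k \<zeta> \<longleftrightarrow> roots_of_unity k = range (\<lambda>i::int. \<zeta> powi i)"

text \<open>
  For \<open>k > 0\<close> the set below is finite and contains 1, so \<^const>\<open>Max\<close> is the true maximum.
  The polynomial \<open>g\<close> has its coefficients in the same field as \<open>f\<close>.
\<close>

definition max_substitution_exponent :: "nat \<Rightarrow> 'a::field poly \<Rightarrow> nat" where
  "max_substitution_exponent k f =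
     Max {m. m dvd gcd (degree f) k \<and> (\<exists>g :: 'a poly. f = pcompose g (monom 1 m))}"

definition twist :: "'b::field \<Rightarrow> nat \<Rightarrow> nat \<Rightarrow> 'b poly \<Rightarrow> 'b poly" where
  "twist \<zeta> n j f = smult (\<zeta> powi (- int (j * n))) (pcompose f [:0, \<zeta> ^ j:])"

end

theory Submission
  imports Defs
begin

text \<open>
  The coefficient of \<open>X^i\<close> in \<open>\<zeta>^(-jn) f(\<zeta>^j X)\<close> is \<open>\<zeta>^(j(i - n)) f_i\<close>. Since \<open>\<zeta>\<close> has order
  exactly \<open>k\<close>, the polynomials for \<open>j\<close> and \<open>j'\<close> agree iff \<open>k\<close> divides \<open>(j - j') (i - n)\<close> for every \<open>i\<close>
  in the support of \<open>f\<close>. As \<open>0\<close> lies in the support, this says that \<open>k\<close> divides \<open>(j - j') G\<close>, where \<open>G\<close> is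
  the gcd of the support, and \<open>t\<close> turns out to be \<open>gcd G k\<close>.
\<close>

section \<open>Field embeddings and the characteristic\<close>

lemma field_embedding_simps:
  assumes "field_embedding h"
  shows "h 0 = 0" "h 1 = 1" "h (x + y) = h x + h y" "h (x * y) = h x * h y"
proof -
  show "h 1 = 1" "h (x + y) = h x + h y" "h (x * y) = h x * h y" for x y
    using assms by (auto simp: field_embedding_def)
  from this(2)[of 0 0] show "h 0 = 0"
    by (metis add_0_right add_left_cancel)
qed

lemma field_embedding_of_nat:
  assumes "field_embedding h"
  shows "h (of_nat n) = of_nat n"
  by (induction n) (simp_all add: field_embedding_simps[OF assms])

lemma field_embedding_eq_0_iff:
  assumes "field_embedding h"
  shows "h x = 0 \<longleftrightarrow> x = 0"
proof
  assume "h x = 0"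
  show "x = 0"
  proof (rule ccontr)
    assume "x \<noteq> 0"
    then have "h (x * inverse x) = 1"
      by (simp add: field_embedding_simps[OF assms])
    with \<open>h x = 0\<close> show False
      by (simp add: field_embedding_simps[OF assms])
  qed
qed (simp add: field_embedding_simps[OF assms])

text \<open>Translation by 1 permutes the ring, so the sum of all elements is unchanged when each of
  them grows by 1; the total increase is the cardinality.\<close>

lemma of_nat_CARD_eq_0: "of_nat CARD('a) = (0 :: 'a::{ring_1,finite})"
proof -
  have "(\<Sum>x\<in>UNIV. x :: 'a) = (\<Sum>x\<in>UNIV. x + 1)"
    by (rule sum.reindex_bij_witness[of _ "\<lambda>x. x + 1" "\<lambda>x. x - 1"]) auto
  then show ?thesis
    by (simp add: sum.distrib)
qed

text \<open>Otherwise the characteristic of the extension field would divide both \<open>k\<close>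
  and \<open>CARD('a)\<close>, hence be 1, which no field allows. The result is what makes X^k - 1
  separable.\<close>

lemma of_nat_neq_0_if_coprime_CARD:
  fixes h :: "'a::{field,finite} \<Rightarrow> 'b::field"
  assumes "field_embedding h" "coprime k CARD('a)"
  shows "(of_nat k :: 'b) \<noteq> 0"
proof
  assume "(of_nat k :: 'b) = 0"
  then have "CHAR('b) dvd k"
    by (simp add: of_nat_eq_0_iff_char_dvd)
  have "(of_nat CARD('a) :: 'b) = 0"
    using of_nat_CARD_eq_0 field_embedding_of_nat[OF assms(1)] field_embedding_simps(1)[OF assms(1)] by metis
  then have "CHAR('b) dvd CARD('a)"
    by (simp only: of_nat_eq_0_iff_char_dvd)
  with \<open>CHAR('b) dvd k\<close> assms(2) have "CHAR('b) = 1"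
    using coprime_common_divisor_nat by blast
  then show False
    by simp
qed

section \<open>Counting the k-th roots of unity\<close>

lemma order_le_1_if_pderiv_nonzero:
  fixes p :: "'b::field poly"
  assumes "poly (pderiv p) a \<noteq> 0"
  shows "order a p \<le> 1"
proof (rule ccontr)
  assume "\<not> order a p \<le> 1"
  then have "[:- a, 1:] ^ 2 dvd p"
    using order_1[of a p] le_imp_power_dvd[of 2 "order a p" "[:- a, 1:]"] dvd_trans by force
  then obtain r where "p = [:- a, 1:] * ([:- a, 1:] * r)"
    by (metis dvdE mult.assoc power2_eq_square)
  then have "poly (pderiv p) a = 0"
    by (simp add: pderiv_mult del: mult_pCons_left)
  with assms show False ..
qed

text \<open>Splitting makes the multiset \<open>proots p\<close> as large as the degree; simplicity
  of the roots makes every multiplicity 1, so the multiset has as many elements as its underlying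
  set.\<close>

lemma card_roots_of_splits:
  fixes p :: "'b::field poly"
  assumes "splits p" "p \<noteq> 0" and simple: "\<And>x. poly p x = 0 \<Longrightarrow> poly (pderiv p) x \<noteq> 0"
  shows "card {x. poly p x = 0} = degree p"
proof -
  obtain A where A: "p = smult (lead_coeff p) (\<Prod>a\<in>#A. [:- a, 1:])"
    using assms(1) unfolding splits_def by blast
  have nz: "(\<Prod>a\<in>#B. [:- a, 1:]) \<noteq> 0" for B :: "'b multiset"
    by (auto simp: prod_mset_zero_iff)
  have "proots p = proots (\<Prod>a\<in>#A. [:- a, 1:])"
    using A assms(2) by (metis leading_coeff_0_iff proots_smult)
  also have "\<dots> = A"
    by (induction A) (simp_all add: proots_mult[OF _ nz] del: mult_pCons_left)
  finally have "proots p = A" .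
  have "degree (\<Prod>a\<in>#A. [:- a, 1:]) = size A"
    by (induction A) (simp_all add: degree_mult_eq[OF _ nz] del: mult_pCons_left)
  then have "size A = degree p"
    using A assms(2) by (metis degree_smult_eq leading_coeff_0_iff)
  have "count A x = 1" if "x \<in># A" for x
  proof -
    have "x \<in># proots p"
      using that \<open>proots p = A\<close> by simp
    then have "poly p x = 0"
      using assms(2) by simp
    then have "order x p \<le> 1"
      by (intro order_le_1_if_pderiv_nonzero simple)
    with that show ?thesis
      using assms(2) \<open>proots p = A\<close> by (metis One_nat_def count_greater_zero_iff count_proots le_antisym Suc_leI)
  qed
  then have "card (set_mset A) = size A"
    by (simp add: size_multiset_overloaded_eq)
  moreover have "set_mset A = {x. poly p x = 0}"
    using \<open>proots p = A\<close> set_count_proots[OF assms(2)] by simp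
  ultimately show ?thesis
    using \<open>size A = degree p\<close> by simp
qed

lemma card_roots_of_unity:
  assumes "splits (monom 1 k - 1 :: 'b::field poly)" "(of_nat k :: 'b) \<noteq> 0"
  shows "card (roots_of_unity k :: 'b set) = k"
proof -
  let ?p = "monom 1 k - 1 :: 'b poly"
  have "k > 0"
    using assms(2) by (cases k) auto
  have deg: "degree ?p = k"
    using \<open>k > 0\<close> degree_add_eq_left[of "-1" "monom 1 k :: 'b poly"] by (simp add: degree_monom_eq)
  show ?thesis
    unfolding roots_of_unity_def
  proof (subst card_roots_of_splits)
    show "?p \<noteq> 0"
      using deg \<open>k > 0\<close> by force
    show "poly (pderiv ?p) x \<noteq> 0" if "poly ?p x = 0" for x
    proof -
      \<comment> \<open>The derivative k X^(k-1) can vanish only at 0, because \<open>k\<close> is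
        nonzero in the field, and 0 is not a root.\<close>
      have "x \<noteq> 0"
        using that \<open>k > 0\<close> by (auto simp: poly_monom power_0_left)
      then show ?thesis
        using assms(2) by (simp add: pderiv_diff pderiv_monom poly_monom)
    qed
  qed (use assms deg in auto)
qed

section \<open>The order of the generator\<close>

lemma power_int_mod_eq:
  fixes x :: "'b::field"
  assumes "x ^ r = 1" "x \<noteq> 0"
  shows "x powi i = x powi (i mod int r)"
proof -
  have "x powi i = x powi (int r * (i div int r) + i mod int r)"
    by simp
  also have "\<dots> = (x powi int r) powi (i div int r) * x powi (i mod int r)"
    using assms(2) by (simp only: power_int_add power_int_mult simp_thms)
  finally show ?thesis
    using assms(1) by simp
qed

lemma generator_power_eq_1_iff:
  assumes gen: "generates_roots_of_unity k (\<zeta> :: 'b::field)"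
    and card: "card (roots_of_unity k :: 'b set) = k" and "k > 0"
  shows "\<zeta> powi i = 1 \<longleftrightarrow> int k dvd i"
proof -
  have range: "roots_of_unity k = range (\<lambda>i::int. \<zeta> powi i)"
    using gen by (simp add: generates_roots_of_unity_def)
  then have "\<zeta> \<in> roots_of_unity k"
    using rangeI[of "\<lambda>i::int. \<zeta> powi i" 1] by simp
  then have k: "\<zeta> ^ k = 1"
    by (simp add: roots_of_unity_def poly_monom)
  have "\<zeta> \<noteq> 0"
    using k \<open>k > 0\<close> by (auto simp: power_0_left)
  \<comment> \<open>Generation is given only as an equality of sets; the count of the roots turns it
    into a statement about the order. If \<zeta>^r = 1 with 0 < r < k, all integer powers would be
    among r values, too few for k roots.\<close>
  have minimal: "r = 0" if "\<zeta> ^ r = 1" "r < k" for r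
  proof (rule ccontr)
    assume "r \<noteq> 0"
    have "\<zeta> powi i \<in> (\<lambda>i. \<zeta> ^ i) ` {..<r}" for i :: int
    proof -
      have "\<zeta> powi i = \<zeta> ^ nat (i mod int r)"
        using power_int_mod_eq[OF that(1) \<open>\<zeta> \<noteq> 0\<close>, of i] \<open>r \<noteq> 0\<close> by (simp add: power_int_def)
      moreover have "nat (i mod int r) < r"
        using \<open>r \<noteq> 0\<close> by (simp add: nat_less_iff)
      ultimately show ?thesis
        by blast
    qed
    then have "roots_of_unity k \<subseteq> (\<lambda>i. \<zeta> ^ i) ` {..<r}"
      unfolding range by blast
    then have "k \<le> card ((\<lambda>i. \<zeta> ^ i) ` {..<r})"
      using card by (metis card_mono finite_imageI finite_lessThan)
    also have "\<dots> \<le> r"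
      using card_image_le[of "{..<r}" "\<lambda>i. \<zeta> ^ i"] by simp
    finally show False
      using that(2) by simp
  qed
  have "\<zeta> powi i = \<zeta> ^ nat (i mod int k)"
    using power_int_mod_eq[OF k \<open>\<zeta> \<noteq> 0\<close>, of i] \<open>k > 0\<close> by (simp add: power_int_def)
  moreover have "nat (i mod int k) < k"
    using \<open>k > 0\<close> by (simp add: nat_less_iff)
  ultimately have "\<zeta> powi i = 1 \<longleftrightarrow> nat (i mod int k) = 0"
    using minimal by (metis power_0)
  also have "\<dots> \<longleftrightarrow> int k dvd i"
    unfolding dvd_eq_mod_eq_0 using pos_mod_sign[of "int k" i] \<open>k > 0\<close> by linarith
  finally show ?thesis .
qed

section \<open>Substitution of X^m and the gcd of the support\<close>

lemma coeff_pcompose_monom: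
  fixes p :: "'a::comm_semiring_1 poly"
  assumes "m > 0"
  shows "coeff (pcompose p (monom 1 m)) i = (if m dvd i then coeff p (i div m) else 0)"
proof (induction p arbitrary: i)
  case (pCons a p)
  show ?case
  proof (cases "i < m")
    case True
    then show ?thesis
      using assms by (auto simp: pcompose_pCons coeff_pCons coeff_monom_mult dest: dvd_imp_le split: nat.splits)
  next
    case False
    then have "m dvd i \<longleftrightarrow> m dvd i - m" "i div m = Suc ((i - m) div m)" "i > 0"
      using assms by (simp_all add: le_div_geq dvd_minus_self)
    then show ?thesis
      using False pCons.IH[of "i - m"]
      by (auto simp: pcompose_pCons coeff_pCons coeff_monom_mult split: nat.splits)
  qed
qed simp

lemma eq_pcompose_monom_iff:
  fixes f :: "'a::comm_semiring_1 poly"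
  assumes "m > 0"
  shows "(\<exists>g. f = pcompose g (monom 1 m)) \<longleftrightarrow> m dvd Gcd {i. coeff f i \<noteq> 0}"
proof
  assume "\<exists>g. f = pcompose g (monom 1 m)"
  then show "m dvd Gcd {i. coeff f i \<noteq> 0}"
    using assms by (auto simp: dvd_Gcd_iff coeff_pcompose_monom split: if_splits)
next
  assume dvd: "m dvd Gcd {i. coeff f i \<noteq> 0}"
  \<comment> \<open>The witness keeps every m-th coefficient of \<open>f\<close>. Cutting the sum at
    \<open>degree f\<close> loses nothing, since i \<le> i * m.\<close>
  define g where "g = (\<Sum>i\<le>degree f. monom (coeff f (i * m)) i)"
  have "coeff g i = coeff f (i * m)" for i
  proof (cases "i \<le> degree f")
    case True
    then show ?thesis
      by (simp add: g_def coeff_sum)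
  next
    case False
    moreover have "i \<le> i * m"
      using assms by simp
    ultimately have "coeff f (i * m) = 0"
      by (intro coeff_eq_0) linarith
    with False show ?thesis
      by (simp add: g_def coeff_sum)
  qed
  then have "f = pcompose g (monom 1 m)"
    using dvd assms by (intro poly_eqI) (auto simp: coeff_pcompose_monom dvd_Gcd_iff)
  then show "\<exists>g. f = pcompose g (monom 1 m)" ..
qed

text \<open>The degree of a nonzero \<open>f\<close> lies in the support, so the gcd of the support
  divides it. The admissible \<open>m\<close> are therefore all the divisors of a single positive
  number, and the largest is that number itself.\<close>

lemma max_substitution_exponent_eq:
  assumes "k > 0"
  shows "max_substitution_exponent k f = gcd (Gcd {i. coeff f i \<noteq> 0}) k"
proof -
  let ?G = "Gcd {i. coeff f i \<noteq> 0}"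
  have G_dvd: "?G dvd degree f"
    by (cases "f = 0") (auto intro: Gcd_dvd)
  have "m dvd gcd (degree f) k \<and> (\<exists>g. f = pcompose g (monom 1 m)) \<longleftrightarrow> m dvd gcd ?G k" for m
  proof (cases "m = 0")
    \<comment> \<open>Both sides are false for m = 0, as the gcds with k > 0 are positive;
      \<open>eq_pcompose_monom_iff\<close> covers only m > 0.\<close>
    case True
    then show ?thesis
      using assms by simp
  next
    case False
    then show ?thesis
      using eq_pcompose_monom_iff[of m f] dvd_trans[OF _ G_dvd, of m] by auto
  qed
  then have "max_substitution_exponent k f = Max {m. m dvd gcd ?G k}"
    unfolding max_substitution_exponent_def by presburger
  also have "\<dots> = gcd ?G k"
    using assms by (intro Max_eqI) (auto intro: dvd_imp_le simp del: gcd_greatest_iff)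
  finally show ?thesis .
qed

section \<open>Divisibility and gcds\<close>

lemma dvd_mult_iff_div_gcd_dvd:
  fixes k d G :: nat
  assumes "k > 0"
  shows "k dvd d * G \<longleftrightarrow> k div gcd G k dvd d"
proof -
  have "gcd G k > 0"
    using assms by simp
  have "k dvd d * G \<longleftrightarrow> gcd G k * (k div gcd G k) dvd gcd G k * (d * (G div gcd G k))"
    by (simp add: div_mult_swap mult.left_commute)
  also have "\<dots> \<longleftrightarrow> k div gcd G k dvd d * (G div gcd G k)"
    using \<open>gcd G k > 0\<close> by (simp only: nat_mult_dvd_cancel1)
  also have "\<dots> \<longleftrightarrow> k div gcd G k dvd d"
    using assms by (intro coprime_dvd_mult_left_iff) (metis coprime_commute div_gcd_coprime neq0_conv)
  finally show ?thesis .
qed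

lemma dvd_abs_mult_iff: "a dvd \<bar>b\<bar> * c \<longleftrightarrow> a dvd b * c" for a b c :: int
  by (cases "b \<ge> 0") simp_all

lemma dvd_mult_Gcd_iff: "k dvd d * Gcd A \<longleftrightarrow> (\<forall>i\<in>A. k dvd d * i)" for k d :: nat
proof -
  have "d * Gcd A = Gcd ((*) d ` A)"
    by (simp add: Gcd_mult)
  then show ?thesis
    by (simp add: dvd_Gcd_iff)
qed

section \<open>Comparing the twisted polynomials\<close>

lemma coeff_twist:
  assumes "\<zeta> \<noteq> 0"
  shows "coeff (twist \<zeta> n j f) i = \<zeta> powi (int j * (int i - int n)) * coeff f i"
proof -
  have "\<zeta> powi (- int (j * n)) * (\<zeta> ^ j) ^ i = \<zeta> powi (- int (j * n)) * \<zeta> powi int (j * i)"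
    by (simp only: power_int_of_nat power_mult)
  also have "\<dots> = \<zeta> powi (int j * (int i - int n))"
    using assms by (simp only: power_int_add[symmetric] simp_thms) (simp add: algebra_simps)
  finally show ?thesis
    by (simp add: twist_def coeff_pcompose_linear flip: mult.assoc)
qed

theorem theorem6:
  fixes q k n t j j' :: nat
    and h :: "'a::{field,finite} \<Rightarrow> 'b::field"
    and \<zeta> :: 'b
    and f :: "'a poly"
  assumes "primepow q"
    and "CARD('a) = q"
    and "gcd k q = 1"
    and "field_embedding h"
    and "splits (monom 1 k - 1 :: 'b poly)"
    and "generates_roots_of_unity k \<zeta>"
    and "degree f = n"
    and "poly f 0 \<noteq> 0"
    and "t = max_substitution_exponent k f"
    and "j \<le> k - 1"
    and "j' \<le> k - 1"
  shows "twist \<zeta> n j (map_poly h f) = twist \<zeta> n j' (map_poly h f)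
         \<longleftrightarrow> [j = j'] (mod (k div t))"
proof -
  let ?S = "{i. coeff f i \<noteq> 0}"
  let ?D = "int j - int j'"
  have "coprime k CARD('a)"
    using assms(2,3) by (simp add: coprime_iff_gcd_eq_1)
  then have k_nz: "(of_nat k :: 'b) \<noteq> 0"
    using assms(4) by (rule of_nat_neq_0_if_coprime_CARD[rotated])
  then have "k > 0"
    by (cases k) auto
  note order = generator_power_eq_1_iff[OF assms(6) card_roots_of_unity[OF assms(5) k_nz] \<open>k > 0\<close>]
  have "\<zeta> \<noteq> 0"
  proof
    assume "\<zeta> = 0"
    with order[of "int k"] \<open>k > 0\<close> show False
      by (simp add: power_0_left)
  qed
  have powi_eq_iff: "\<zeta> powi a = \<zeta> powi b \<longleftrightarrow> int k dvd a - b" for a b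
    using order[of "a - b"] \<open>\<zeta> \<noteq> 0\<close> by (simp add: power_int_diff)
  have "0 \<in> ?S"
    using assms(8) by (simp add: poly_0_coeff_0)
  then have "n \<in> ?S"
    using assms(7) by auto
  \<comment> \<open>As \<open>h\<close> vanishes only at 0, \<open>map_poly h f\<close> has the
    support of \<open>f\<close>, and outside it both coefficients are 0.\<close>
  have "twist \<zeta> n j (map_poly h f) = twist \<zeta> n j' (map_poly h f) \<longleftrightarrow>
      (\<forall>i\<in>?S. int k dvd int j * (int i - int n) - int j' * (int i - int n))"
    using \<open>\<zeta> \<noteq> 0\<close>
    by (auto simp: poly_eq_iff coeff_twist coeff_map_poly field_embedding_simps[OF assms(4)]
        field_embedding_eq_0_iff[OF assms(4)] powi_eq_iff)
  also have "\<dots> \<longleftrightarrow> (\<forall>i\<in>?S. int k dvd ?D * int i - ?D * int n)"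
    by (simp add: algebra_simps)
  \<comment> \<open>The index 0 isolates the shift \<open>?D * int n\<close>, which can then be
    removed from every other condition; conversely, \<open>n\<close> is itself in the
    support.\<close>
  also have "\<dots> \<longleftrightarrow> (\<forall>i\<in>?S. int k dvd ?D * int i)"
  proof
    assume *: "\<forall>i\<in>?S. int k dvd ?D * int i - ?D * int n"
    then have "int k dvd ?D * int n"
      using bspec[OF * \<open>0 \<in> ?S\<close>] by simp
    with * show "\<forall>i\<in>?S. int k dvd ?D * int i"
      by (metis dvd_add diff_add_cancel)
  qed (use \<open>n \<in> ?S\<close> in \<open>blast intro: dvd_diff\<close>)
  \<comment> \<open>The sign of \<open>?D\<close> is irrelevant to divisibility; the absolute value
    moves the conditions to the naturals, where the \<open>Gcd\<close> of the support lives.\<close>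
  also have "\<dots> \<longleftrightarrow> (\<forall>i\<in>?S. k dvd nat \<bar>?D\<bar> * i)"
    by (simp add: dvd_abs_mult_iff flip: int_dvd_int_iff)
  also have "\<dots> \<longleftrightarrow> k div t dvd nat \<bar>?D\<bar>"
    unfolding assms(9) max_substitution_exponent_eq[OF \<open>k > 0\<close>]
    by (simp only: dvd_mult_iff_div_gcd_dvd[OF \<open>k > 0\<close>, symmetric] dvd_mult_Gcd_iff)
  also have "\<dots> \<longleftrightarrow> [j = j'] (mod (k div t))"
    by (simp add: cong_iff_dvd_diff flip: cong_int_iff)
  finally show ?thesis .
qed

end
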